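(* Let $(X_i,Y_i)$, $i\ge1$, be i.i.d. copies of $(X,Y)$ satisfying $h(Y)=g(X)+\varepsilon$ with a fixed transformation $h$ as in the context. Assume: (1) $C_1\subset(0,\infty)$, $C_2\subset\mathbb R$ and $\Theta\subset\mathbb R^{d_\Theta}$ are compact. (2) The weight function $w\ge0$ is continuous with compact support $\mathcal Y_w$ contained in the support of $Y$. (3) $(y,\theta)\mapsto\Lambda_\theta(y)$ is twice continuously differentiable with respect to $\theta$ for $y\in\mathcal Y_w$, and the (partial) derivatives are continuous in $(y,\theta)\in\mathcal Y_w\times\Theta$. (4) There is a unique strictly increasing and continuous transformation $h$ (normalized by $h(0)=0,h(1)=1$) such that $h(Y)=g(X)+\varepsilon$ holds with $X$ independent of $\varepsilon$. (5) The function $M:\Upsilon\to\mathbb R$, $M(c_1,c_2,\theta)=E[w(Y)(h(Y)c_1+c_2-\Lambda_\theta(Y))^2]$, has a unique minimizer $\gamma_0=(c_{1,0},c_{2,0},\theta_0)$, and it lies in the interior of $\Upsilon$. For all $\theta\ne\tilde\theta$ in $\Theta$, $$\sup_{y\in\operatorname{supp}(w)}\Big|\tfrac{\Lambda_\theta(y)-\Lambda_\theta(0)}{\Lambda_\theta(1)-\Lambda_\theta(0)}-\tfrac{\Lambda_{\tilde\theta}(y)-\Lambda_{\tilde\theta}(0)}{\Lambda_{\tilde\theta}(1)-\Lambda_{\tilde\theta}(0)}\Big|>0.$$ (6) $\hat h$ estimates $h$ uniformly consistently on compact sets: $\sup_{y\in\mathcal K}|\hat h(y)-h(y)|=o_P(1)$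 for every compact $\mathcal K\subset\mathbb R$. Then, under the alternative $H_1$: $d(\Lambda_\theta,h)>0$ for all $\theta\in\Theta$, one has $$\lim_{n\to\infty}P(T_n>q)=1\quad\text{for all }q\in\mathbb R,$$ that is, the test rejecting for large values of $T_n$ is consistent.
   Context: Model. $\{\Lambda_\theta:\theta\in\Theta\}$ is a class of strictly increasing functions $\Lambda_\theta:\mathbb R\to\mathbb R$, $\Theta\subset\mathbb R^{d_\Theta}$. $X$ is $\mathbb R^{d_X}$-valued, $Y$ is real-valued, $E[\varepsilon]=0$, $\varepsilon$ is independent of $X$, and $h:\mathbb R\to\mathbb R$ is strictly increasing, not depending on $n$, normalized by $h(0)=0$, $h(1)=1$. Distance: $d(\Lambda_\theta,h)=\min_{c_1\in(0,\infty),\,c_2\in\mathbb R}E\big[w(Y)\{h(Y)c_1+c_2-\Lambda_\theta(Y)\}^2\big]$. Test statistic: $\Upsilon=C_1\times C_2\times\Theta$ and $$T_n=\min_{(c_1,c_2,\theta)\in\Upsilon}\sum_{j=1}^nw(Y_j)\{\hat h(Y_j)c_1+c_2-\Lambda_\theta(Y_j)\}^2,$$ where $\hat h$ is an estimator of $h$ based on $(X_i,Y_i)$, $i\le n$. *)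

theory Defs
  imports "HOL-Probability.Probability"
begin

definition func_support :: "(real \<Rightarrow> real) \<Rightarrow> real set" where
  "func_support w = closure {y. w y \<noteq> 0}"

definition law_support :: "'a measure \<Rightarrow> ('a \<Rightarrow> real) \<Rightarrow> real set" where
  "law_support M Y =
     {y. \<forall>U. open U \<and> y \<in> U \<longrightarrow> measure M {\<omega> \<in> space M. Y \<omega> \<in> U} > 0}"

(* The library's indep_var only covers two variables with values in the same type. *)
definition independent_rvs ::
  "'a measure \<Rightarrow> ('a \<Rightarrow> 'b::topological_space) \<Rightarrow> ('a \<Rightarrow> 'c::topological_space) \<Rightarrow> bool" where
  "independent_rvs M U V \<longleftrightarrow>
     U \<in> borel_measurable M \<and> V \<in> borel_measurable M \<and>
     prob_space.indep_set M (sets (vimage_algebra (space M) U borel))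
                            (sets (vimage_algebra (space M) V borel))"

definition transformation_model ::
  "'a measure \<Rightarrow> ('a \<Rightarrow> real ^ 'x) \<Rightarrow> ('a \<Rightarrow> real) \<Rightarrow>
   (real \<Rightarrow> real) \<Rightarrow> (real ^ 'x \<Rightarrow> real) \<Rightarrow> ('a \<Rightarrow> real) \<Rightarrow> bool" where
  "transformation_model M X Y h g eps \<longleftrightarrow>
     g \<in> borel_measurable borel \<and>
     integrable M eps \<and> integral\<^sup>L M eps = 0 \<and>
     independent_rvs M X eps \<and>
     (AE \<omega> in M. h (Y \<omega>) = g (X \<omega>) + eps \<omega>)"

definition normalized_transformation :: "(real \<Rightarrow> real) \<Rightarrow> bool" where
  "normalized_transformation h \<longleftrightarrow> strict_mono h \<and> h 0 = 0 \<and> h 1 = 1"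

definition iid_copies ::
  "'a measure \<Rightarrow> (nat \<Rightarrow> 'a \<Rightarrow> 'b::topological_space) \<Rightarrow> nat set \<Rightarrow> ('a \<Rightarrow> 'b) \<Rightarrow> bool" where
  "iid_copies M Zs I Z \<longleftrightarrow>
     prob_space.indep_vars M (\<lambda>_. borel) Zs I \<and>
     (\<forall>i\<in>I. distr M borel (Zs i) = distr M borel Z)"

(* Theta need not be open: derivatives are taken relative to Theta, which is the ordinary
   notion at interior points.  D1 is the gradient and D2 the Hessian in theta. *)
definition C2_in_parameter ::
  "(real ^ 't \<Rightarrow> real \<Rightarrow> real) \<Rightarrow> real set \<Rightarrow> (real ^ 't) set \<Rightarrow> bool" where
  "C2_in_parameter \<Lambda> S \<Theta> \<longleftrightarrow>
     (\<exists>(D1 :: real \<Rightarrow> real ^ 't \<Rightarrow> real ^ 't) (D2 :: real \<Rightarrow> real ^ 't \<Rightarrow> real ^ 't ^ 't).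
        (\<forall>y\<in>S. \<forall>\<theta>\<in>\<Theta>.
           ((\<lambda>\<theta>'. \<Lambda> \<theta>' y) has_derivative (\<lambda>v. D1 y \<theta> \<bullet> v)) (at \<theta> within \<Theta>) \<and>
           (D1 y has_derivative (\<lambda>v. D2 y \<theta> *v v)) (at \<theta> within \<Theta>)) \<and>
        continuous_on (S \<times> \<Theta>) (\<lambda>(y, \<theta>). D1 y \<theta>) \<and>
        continuous_on (S \<times> \<Theta>) (\<lambda>(y, \<theta>). D2 y \<theta>))"

definition criterion ::
  "'a measure \<Rightarrow> (real \<Rightarrow> real) \<Rightarrow> ('a \<Rightarrow> real) \<Rightarrow> (real \<Rightarrow> real) \<Rightarrow> (real ^ 't \<Rightarrow> real \<Rightarrow> real) \<Rightarrow>
   real \<times> real \<times> (real ^ 't) \<Rightarrow> real" where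
  "criterion M w Y h \<Lambda> =
     (\<lambda>(c1, c2, \<theta>). \<integral>\<omega>. w (Y \<omega>) * (h (Y \<omega>) * c1 + c2 - \<Lambda> \<theta> (Y \<omega>))\<^sup>2 \<partial>M)"

(* The minimum is written as an infimum of a set of nonnegative reals; the two agree
   whenever the minimum is attained. *)
definition transformation_dist ::
  "'a measure \<Rightarrow> (real \<Rightarrow> real) \<Rightarrow> ('a \<Rightarrow> real) \<Rightarrow> (real \<Rightarrow> real) \<Rightarrow> (real \<Rightarrow> real) \<Rightarrow> real" where
  "transformation_dist M w Y f h =
     (INF (c1, c2) \<in> {0<..} \<times> UNIV.
        \<integral>\<omega>. w (Y \<omega>) * (h (Y \<omega>) * c1 + c2 - f (Y \<omega>))\<^sup>2 \<partial>M)"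

(* The statistic T_n as a function of the estimated transformation k and the observations
   y 1, ..., y n.  The infimum is attained when Ups is compact and nonempty and the sum is
   continuous in the parameters. *)
definition test_statistic ::
  "(real \<Rightarrow> real) \<Rightarrow> (real ^ 't \<Rightarrow> real \<Rightarrow> real) \<Rightarrow> (real \<times> real \<times> (real ^ 't)) set \<Rightarrow>
   nat \<Rightarrow> (real \<Rightarrow> real) \<Rightarrow> (nat \<Rightarrow> real) \<Rightarrow> real" where
  "test_statistic w \<Lambda> \<Upsilon> n k y =
     (INF (c1, c2, \<theta>) \<in> \<Upsilon>. \<Sum>j=1..n. w (y j) * (k (y j) * c1 + c2 - \<Lambda> \<theta> (y j))\<^sup>2)"

(* Convergence to 0 in probability through outer probability, since a supremum over an
   uncountable set need not be measurable; for measurable Z n this is the usual notion. *)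
definition oP_one :: "'a measure \<Rightarrow> (nat \<Rightarrow> 'a \<Rightarrow> ennreal) \<Rightarrow> bool" where
  "oP_one M Z \<longleftrightarrow>
     (\<forall>e::real. e > 0 \<longrightarrow>
        (\<lambda>n. outer_measure_of M {\<omega> \<in> space M. Z n \<omega> > ennreal e}) \<longlonglongrightarrow> 0)"

end

theory Submission
  imports Defs
begin

text \<open>
  Under \<open>H1\<close> the population criterion is bounded below by some \<open>m > 0\<close> on \<open>\<Upsilon>\<close>.  A one-sided uniform
  law of large numbers keeps the empirical criterion with the true \<open>h\<close> above \<open>n * m / 2\<close>, and the
  uniform consistency of the estimator costs at most another \<open>n * m / 4\<close>, so the statistic
  exceeds \<open>n * m / 4\<close> with probability tending to one.
\<close>

section \<open>Infima over uncountable parameter sets\<close>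

lemma INF_dense_subset:
  fixes f :: "'p::topological_space \<Rightarrow> real"
  assumes cont: "continuous_on U f" and sub: "D \<subseteq> U" and dense: "U \<subseteq> closure D"
    and ne: "U \<noteq> {}" and bdd: "bdd_below (f ` U)"
  shows "(INF x\<in>U. f x) = (INF x\<in>D. f x)"
proof (rule antisym)
  have D: "D \<noteq> {}"
    using dense ne by auto
  show "(INF x\<in>U. f x) \<le> (INF x\<in>D. f x)"
    using D sub bdd by (intro cINF_superset_mono) auto
  have bddD: "bdd_below (f ` D)"
    using bdd sub by (meson bdd_below_mono image_mono)
  \<comment> \<open>The set where \<open>f\<close> is at least its infimum over \<open>D\<close> is
    relatively closed in \<open>U\<close> and contains \<open>D\<close>, so by density it is all of
    \<open>U\<close>.\<close>
  have "closedin (top_of_set U) (U \<inter> f -` {(INF x\<in>D. f x)..})"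
    using cont by (intro continuous_closedin_preimage) auto
  then obtain S where S: "closed S" "U \<inter> f -` {(INF x\<in>D. f x)..} = U \<inter> S"
    by (auto simp: closedin_closed)
  have "D \<subseteq> S"
    using S(2) sub bddD by (auto intro: cINF_lower)
  then have "U \<subseteq> S"
    using dense S(1) by (meson closure_minimal subset_trans)
  then show "(INF x\<in>D. f x) \<le> (INF x\<in>U. f x)"
    using S(2) ne by (intro cINF_greatest) auto
qed

text \<open>Measurability survives the uncountable infimum because continuity in the parameter
  reduces it to a countable dense subset of \<open>U\<close>. This serves both the infima over small
  balls and the test statistic.\<close>

lemma borel_measurable_INF_continuous:
  fixes f :: "'p::{metric_space, second_countable_topology} \<Rightarrow> 'a \<Rightarrow> real"
  assumes meas: "\<And>p. p \<in> U \<Longrightarrow> f p \<in> borel_measurable N"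
    and cont: "\<And>x. x \<in> space N \<Longrightarrow> continuous_on U (\<lambda>p. f p x)"
    and bdd: "\<And>x. x \<in> space N \<Longrightarrow> bdd_below ((\<lambda>p. f p x) ` U)"
    and ne: "U \<noteq> {}"
  shows "(\<lambda>x. INF p\<in>U. f p x) \<in> borel_measurable N"
proof -
  obtain D where D: "countable D" "D \<subseteq> U" "U \<subseteq> closure D"
    using separable[of U] by blast
  have "(\<lambda>x. INF p\<in>D. f p x) \<in> borel_measurable N"
    using D meas by (intro borel_measurable_cINF_real) auto
  also have "?this \<longleftrightarrow> ?thesis"
    by (intro measurable_cong INF_dense_subset[symmetric] cont D bdd ne)
  finally show ?thesis .
qed

text \<open>The centre \<open>p\<close> lies in every ball, so no infimum exceeds
  \<open>f p\<close>; continuity at \<open>p\<close> gives the matching lower bound once the radius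
  is small. It supplies the pointwise limit for dominated convergence in the uniform law.\<close>

lemma INF_ball_tendsto:
  fixes f :: "'p::metric_space \<Rightarrow> real"
  assumes cont: "continuous_on U f" and p: "p \<in> U" and bdd: "bdd_below (f ` U)"
  shows "(\<lambda>k. INF q\<in>U \<inter> ball p (1 / real (Suc k)). f q) \<longlonglongrightarrow> f p"
proof (rule LIMSEQ_I)
  fix r :: real assume r: "0 < r"
  \<comment> \<open>Half of \<open>r\<close> is used because passing to the infimum turns a strict
    inequality into a weak one.\<close>
  obtain d where d: "d > 0" "\<And>q. q \<in> U \<Longrightarrow> dist q p < d \<Longrightarrow> dist (f q) (f p) < r / 2"
    using cont p r unfolding continuous_on_iff by (metis half_gt_zero)
  obtain K where K: "1 / real (Suc K) < d"
    using d(1) nat_approx_posE by (metis of_nat_Suc)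
  show "\<exists>K. \<forall>k\<ge>K. norm ((INF q\<in>U \<inter> ball p (1 / real (Suc k)). f q) - f p) < r"
  proof (intro exI allI impI)
    fix k assume k: "K \<le> k"
    have "1 / real (Suc k) \<le> 1 / real (Suc K)"
      using k by (intro divide_left_mono) auto
    then have small: "1 / real (Suc k) < d"
      using K by linarith
    have "(INF q\<in>U \<inter> ball p (1 / real (Suc k)). f q) \<le> f p"
      using p bdd by (intro cINF_lower) (auto intro: bdd_below_mono)
    moreover have "f p - r / 2 \<le> (INF q\<in>U \<inter> ball p (1 / real (Suc k)). f q)"
    proof (rule cINF_greatest)
      fix q assume q: "q \<in> U \<inter> ball p (1 / real (Suc k))"
      then have "dist (f q) (f p) < r / 2"
        using small by (intro d) (auto simp: dist_commute)
      then show "f p - r / 2 \<le> f q"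
        unfolding dist_real_def by linarith
    qed (use p in auto)
    ultimately show "norm ((INF q\<in>U \<inter> ball p (1 / real (Suc k)). f q) - f p) < r"
      using r by simp
  qed
qed

section \<open>Laws of large numbers and exceptional events\<close>

lemma iid_copies_compose:
  fixes Zs :: "nat \<Rightarrow> 'a \<Rightarrow> 'b::topological_space" and \<phi> :: "'b \<Rightarrow> 'c::topological_space"
  assumes "prob_space M" "iid_copies M Zs I Z" "Z \<in> borel_measurable M"
    and [measurable]: "\<phi> \<in> borel_measurable borel"
  shows "iid_copies M (\<lambda>i \<omega>. \<phi> (Zs i \<omega>)) I (\<lambda>\<omega>. \<phi> (Z \<omega>))"
proof -
  interpret prob_space M by fact
  have ind: "indep_vars (\<lambda>_. borel) Zs I"
    and law: "\<And>i. i \<in> I \<Longrightarrow> distr M borel (Zs i) = distr M borel Z"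
    using assms(2) by (auto simp: iid_copies_def)
  have "distr M borel (\<lambda>\<omega>. \<phi> (Zs i \<omega>)) = distr M borel (\<lambda>\<omega>. \<phi> (Z \<omega>))" if i: "i \<in> I" for i
  proof -
    have "random_variable borel (Zs i)"
      using ind i by (auto simp: indep_vars_def)
    then have "distr (distr M borel (Zs i)) borel \<phi> = distr M borel (\<lambda>\<omega>. \<phi> (Zs i \<omega>))"
      by (subst distr_distr) (auto simp: comp_def)
    moreover have "distr (distr M borel Z) borel \<phi> = distr M borel (\<lambda>\<omega>. \<phi> (Z \<omega>))"
      using assms(3) by (subst distr_distr) (auto simp: comp_def)
    ultimately show ?thesis
      using law[OF i] by simp
  qed
  then show ?thesis
    unfolding iid_copies_def by (auto intro!: indep_vars_compose2[OF ind])
qed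

text \<open>With \<open>e\<close> the gap between the mean and \<delta>, the event says that the
  sample mean falls short of its expectation by at least \<open>e\<close>. Hoeffding's inequality
  bounds its probability by a term decaying exponentially in \<open>n\<close>.\<close>

lemma weak_law_lower_bound:
  fixes V :: "'a \<Rightarrow> real"
  assumes "prob_space M" and iid: "iid_copies M Vs {1..} V"
    and V: "V \<in> borel_measurable M"
    and bounds: "\<And>\<omega>. \<omega> \<in> space M \<Longrightarrow> V \<omega> \<in> {0..B}"
    and mean: "\<delta> < (\<integral>\<omega>. V \<omega> \<partial>M)"
  shows "(\<lambda>n. measure M {\<omega> \<in> space M. (\<Sum>j=1..n. Vs j \<omega>) \<le> real n * \<delta>}) \<longlonglongrightarrow> 0"
proof -
  interpret prob_space M by fact
  define \<mu> where "\<mu> = expectation V"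
  define e where "e = \<mu> - \<delta>"
  have e: "e > 0"
    using mean by (simp add: e_def \<mu>_def)
  \<comment> \<open>The maximum with 1 keeps the interval \<open>{0..b}\<close> nondegenerate even
    if \<open>B\<close> is 0; Hoeffding's exponent divides by its squared length.\<close>
  define b where "b = max B 1"
  have b: "b > 0" by (simp add: b_def)
  have bound: "prob {\<omega> \<in> space M. (\<Sum>j=1..n. Vs j \<omega>) \<le> real n * \<delta>} \<le> exp (- 2 * e\<^sup>2 / b\<^sup>2 * real n)"
    if n: "n > 0" for n
  proof -
    interpret Hoeffding_ineq_iid M "{1..n}" Vs V 0 b \<mu>
    proof unfold_locales
      show "indep_vars (\<lambda>_. borel) Vs {1..n}"
        using iid unfolding iid_copies_def by (auto intro: indep_vars_subset)
      show "AE x in M. V x \<in> {0..b}"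
        using bounds by (intro AE_I2) (auto simp: b_def le_max_iff_disj)
    qed (use iid V \<mu>_def in \<open>auto simp: iid_copies_def\<close>)
    have "prob {\<omega> \<in> space M. (\<Sum>j=1..n. Vs j \<omega>) \<le> real n * \<delta>}
      = prob {\<omega> \<in> space M. (\<Sum>j=1..n. Vs j \<omega>) / real (card {1..n}) \<le> \<mu> - e}"
      using n by (simp add: e_def field_simps)
    also have "\<dots> \<le> exp (- 2 * real (card {1..n}) * e\<^sup>2 / (b - 0)\<^sup>2)"
      using n e b by (intro Hoeffding_ineq_le') auto
    finally show ?thesis
      by (simp add: field_simps)
  qed
  have "filterlim (\<lambda>n. 2 * e\<^sup>2 / b\<^sup>2 * real n) at_top sequentially"
    using e b by (intro filterlim_tendsto_pos_mult_at_top[OF tendsto_const] filterlim_real_sequentially) auto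
  then have "filterlim (\<lambda>n. - (2 * e\<^sup>2 / b\<^sup>2 * real n)) at_bot sequentially"
    by (simp add: filterlim_uminus_at_bot)
  then have "(\<lambda>n. exp (- 2 * e\<^sup>2 / b\<^sup>2 * real n)) \<longlonglongrightarrow> 0"
    by (intro filterlim_compose[OF exp_at_bot]) simp
  moreover have "eventually (\<lambda>n. norm (prob {\<omega> \<in> space M. (\<Sum>j=1..n. Vs j \<omega>) \<le> real n * \<delta>})
      \<le> exp (- 2 * e\<^sup>2 / b\<^sup>2 * real n)) sequentially"
    using eventually_gt_at_top[of 0] by eventually_elim (simp only: real_norm_def abs_of_nonneg measure_nonneg bound)
  ultimately show ?thesis
    by (rule Lim_null_comparison[rotated])
qed

text \<open>
  Wald's argument: by dominated convergence the mean of the infimum of the family over a small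
  ball still exceeds \<open>\<delta>\<close>, and finitely many such balls cover the parameter set.  Continuity is
  only needed in the parameter.
\<close>

lemma uniform_law_lower_bound:
  fixes f :: "'p::{metric_space, second_countable_topology} \<Rightarrow> real \<Rightarrow> real"
  assumes "prob_space M" and iid: "iid_copies M Ys {1..} Y"
    and Y[measurable]: "Y \<in> borel_measurable M"
    and U: "compact U"
    and meas: "\<And>p. p \<in> U \<Longrightarrow> f p \<in> borel_measurable borel"
    and cont: "\<And>y. continuous_on U (\<lambda>p. f p y)"
    and bounds: "\<And>p y. p \<in> U \<Longrightarrow> f p y \<in> {0..B}"
    and mean: "\<And>p. p \<in> U \<Longrightarrow> \<delta> < (\<integral>\<omega>. f p (Y \<omega>) \<partial>M)"
  obtains A where "\<And>n. A n \<in> sets M" "(\<lambda>n. measure M (A n)) \<longlonglongrightarrow> 0"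
    "\<And>n \<omega> p. \<omega> \<in> space M - A n \<Longrightarrow> p \<in> U \<Longrightarrow> real n * \<delta> \<le> (\<Sum>j=1..n. f p (Ys j \<omega>))"
proof -
  interpret prob_space M by fact
  \<comment> \<open>The lower envelope of the family near \<open>p\<close>; \<open>Suc\<close> keeps
    the radius well defined and positive at \<open>k = 0\<close>.\<close>
  define \<phi> where "\<phi> p k y = (INF q\<in>U \<inter> ball p (1 / real (Suc k)). f q y)" for p k y
  have bdd: "bdd_below ((\<lambda>q. f q y) ` V)" if "V \<subseteq> U" for V y
    using bounds that by (intro bdd_belowI[of _ 0]) auto
  have \<phi>_meas[measurable]: "\<phi> p k \<in> borel_measurable borel" if "p \<in> U" for p k
    unfolding \<phi>_def using that
    by (intro borel_measurable_INF_continuous)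
       (auto intro!: meas bdd continuous_on_subset[OF cont])
  have \<phi>_le: "\<phi> p k y \<le> f q y" if "q \<in> U" "dist p q < 1 / real (Suc k)" for p q k y
    unfolding \<phi>_def using that by (intro cINF_lower bdd) auto
  have \<phi>_bounds: "\<phi> p k y \<in> {0..B}" if "p \<in> U" for p k y
  proof -
    have "0 \<le> \<phi> p k y"
      unfolding \<phi>_def using that bounds by (intro cINF_greatest) auto
    moreover have "\<phi> p k y \<le> f p y"
      using that by (intro \<phi>_le) auto
    ultimately show ?thesis
      using bounds[OF that, of y] by auto
  qed
  have "\<exists>k. \<delta> < expectation (\<lambda>\<omega>. \<phi> p k (Y \<omega>))" if p: "p \<in> U" for p
  proof -
    have "(\<lambda>k. expectation (\<lambda>\<omega>. \<phi> p k (Y \<omega>))) \<longlonglongrightarrow> expectation (\<lambda>\<omega>. f p (Y \<omega>))"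
    proof (rule integral_dominated_convergence[where w = "\<lambda>_. B"])
      show "AE \<omega> in M. (\<lambda>k. \<phi> p k (Y \<omega>)) \<longlonglongrightarrow> f p (Y \<omega>)"
        unfolding \<phi>_def by (intro AE_I2 INF_ball_tendsto cont bdd p) auto
    qed (use p meas[OF p] \<phi>_bounds[OF p] in auto)
    then have "eventually (\<lambda>k. \<delta> < expectation (\<lambda>\<omega>. \<phi> p k (Y \<omega>))) sequentially"
      using mean[OF p] by (rule order_tendstoD)
    then show ?thesis
      by (auto simp: eventually_sequentially)
  qed
  then obtain k where k: "\<And>p. p \<in> U \<Longrightarrow> \<delta> < expectation (\<lambda>\<omega>. \<phi> p (k p) (Y \<omega>))"
    by metis
  obtain F where F: "F \<subseteq> U" "finite F" "U \<subseteq> (\<Union>p\<in>F. ball p (1 / real (Suc (k p))))"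
    by (rule compactE_image[OF U, of U "\<lambda>p. ball p (1 / real (Suc (k p)))"]) auto
  \<comment> \<open>The event that the law of large numbers fails for the envelope on the ball
    around \<open>p\<close>. The radius was chosen so that the mean of this envelope is still
    strictly above \<delta>.\<close>
  define E where "E p n = {\<omega> \<in> space M. (\<Sum>j=1..n. \<phi> p (k p) (Ys j \<omega>)) \<le> real n * \<delta>}" for p n
  have Ys: "Ys j \<in> borel_measurable M" if "j \<ge> 1" for j
    using iid that by (auto simp: iid_copies_def indep_vars_def)
  have E_sets: "E p n \<in> sets M" if "p \<in> U" for p n
  proof -
    have [measurable]: "(\<lambda>\<omega>. \<Sum>j=1..n. \<phi> p (k p) (Ys j \<omega>)) \<in> borel_measurable M"
      using that by (intro borel_measurable_sum measurable_compose[OF Ys \<phi>_meas]) auto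
    show ?thesis unfolding E_def by measurable
  qed
  have E_lim: "(\<lambda>n. prob (E p n)) \<longlonglongrightarrow> 0" if "p \<in> U" for p
    unfolding E_def using that
    by (intro weak_law_lower_bound[where V = "\<lambda>\<omega>. \<phi> p (k p) (Y \<omega>)" and B = B]
          prob_space_axioms iid_copies_compose[OF prob_space_axioms iid Y] \<phi>_meas \<phi>_bounds k
          measurable_compose[OF Y])
  show ?thesis
  proof (rule that[of "\<lambda>n. \<Union>p\<in>F. E p n"])
    show "(\<Union>p\<in>F. E p n) \<in> sets M" for n
      using F(1,2) E_sets by (intro sets.finite_UN) auto
    \<comment> \<open>The cover \<open>F\<close> is finite and does not depend on \<open>n\<close>,
      so the union bound tends to 0 term by term.\<close>
    have "(\<lambda>n. \<Sum>p\<in>F. prob (E p n)) \<longlonglongrightarrow> (\<Sum>p\<in>F. 0)"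
      using F E_lim by (intro tendsto_sum) auto
    then have "(\<lambda>n. \<Sum>p\<in>F. prob (E p n)) \<longlonglongrightarrow> 0"
      by simp
    moreover have "prob (\<Union>p\<in>F. E p n) \<le> (\<Sum>p\<in>F. prob (E p n))" for n
      using F(1,2) E_sets by (intro measure_UNION_le) auto
    then have "eventually (\<lambda>n. norm (prob (\<Union>p\<in>F. E p n)) \<le> (\<Sum>p\<in>F. prob (E p n))) sequentially"
      by (intro always_eventually allI) simp
    ultimately show "(\<lambda>n. prob (\<Union>p\<in>F. E p n)) \<longlonglongrightarrow> 0"
      by (rule Lim_null_comparison[rotated])
  next
    fix n \<omega> q assume \<omega>: "\<omega> \<in> space M - (\<Union>p\<in>F. E p n)" and q: "q \<in> U"
    then obtain p where p: "p \<in> F" "dist p q < 1 / real (Suc (k p))"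
      using F(3) by auto
    have "real n * \<delta> \<le> (\<Sum>j=1..n. \<phi> p (k p) (Ys j \<omega>))"
      using \<omega> p(1) by (auto simp: E_def)
    \<comment> \<open>One inequality for the centre \<open>p\<close> settles every \<open>q\<close>
      in its ball, since the envelope lies below all of these \<open>f q\<close>.\<close>
    also have "\<dots> \<le> (\<Sum>j=1..n. f q (Ys j \<omega>))"
      using q p by (intro sum_mono \<phi>_le)
    finally show "real n * \<delta> \<le> (\<Sum>j=1..n. f q (Ys j \<omega>))" .
  qed
qed

text \<open>Outer measure is attained by a measurable superset. Convergence in outer probability
  thus becomes a statement about genuine events, outside which the bound holds pointwise even though
  \<open>Z n\<close> need not be measurable.\<close>

lemma oP_one_exceptional_set:
  assumes "oP_one M Z" "prob_space M" "e > 0"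
  obtains B where "\<And>n. B n \<in> sets M" "(\<lambda>n. measure M (B n)) \<longlonglongrightarrow> 0"
    "\<And>n \<omega>. \<omega> \<in> space M - B n \<Longrightarrow> Z n \<omega> \<le> ennreal e"
proof -
  interpret prob_space M by fact
  define S where "S n = {\<omega> \<in> space M. Z n \<omega> > ennreal e}" for n
  have "\<exists>B\<in>sets M. S n \<subseteq> B \<and> outer_measure_of M (S n) = emeasure M B" for n
    by (intro outer_measure_of_attain) (auto simp: S_def)
  then obtain B where B: "\<And>n. B n \<in> sets M" "\<And>n. S n \<subseteq> B n"
      "\<And>n. outer_measure_of M (S n) = emeasure M (B n)"
    by metis
  have "(\<lambda>n. outer_measure_of M (S n)) \<longlonglongrightarrow> 0"
    using assms(1,3) by (simp add: oP_one_def S_def)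
  then have "(\<lambda>n. ennreal (prob (B n))) \<longlonglongrightarrow> ennreal 0"
    by (simp add: B(3) emeasure_eq_measure)
  then have "(\<lambda>n. prob (B n)) \<longlonglongrightarrow> 0"
    by (subst (asm) tendsto_ennreal_iff) auto
  moreover have "Z n \<omega> \<le> ennreal e" if "\<omega> \<in> space M - B n" for n \<omega>
    using that B(2)[of n] by (auto simp: S_def)
  ultimately show ?thesis
    using that B(1) by blast
qed

section \<open>Continuity and bounds of the weighted residuals\<close>

lemma continuous_on_C2_in_parameter:
  assumes "C2_in_parameter \<Lambda> S \<Theta>" "y \<in> S"
  shows "continuous_on \<Theta> (\<lambda>\<theta>. \<Lambda> \<theta> y)"
  using assms unfolding C2_in_parameter_def continuous_on_eq_continuous_within
  by (blast intro: has_derivative_continuous)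

text \<open>
  No joint continuity is available; monotonicity bounds the family by its values at the two
  endpoints of \<open>S\<close>, which are continuous in the parameter.
\<close>

lemma bounded_monotone_family:
  fixes \<Lambda> :: "'p::topological_space \<Rightarrow> real \<Rightarrow> real"
  assumes "compact S" "compact \<Theta>"
    and mono: "\<And>\<theta>. \<theta> \<in> \<Theta> \<Longrightarrow> mono (\<Lambda> \<theta>)"
    and cont: "\<And>y. y \<in> S \<Longrightarrow> continuous_on \<Theta> (\<lambda>\<theta>. \<Lambda> \<theta> y)"
  obtains B where "B \<ge> 0" "\<And>\<theta> y. \<theta> \<in> \<Theta> \<Longrightarrow> y \<in> S \<Longrightarrow> \<bar>\<Lambda> \<theta> y\<bar> \<le> B"
proof (cases "S = {}")
  case True
  then show ?thesis using that[of 0] by auto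
next
  case False
  obtain a where a: "a \<in> S" "\<And>y. y \<in> S \<Longrightarrow> a \<le> y"
    using compact_attains_inf[OF assms(1) False] by auto
  obtain b where b: "b \<in> S" "\<And>y. y \<in> S \<Longrightarrow> y \<le> b"
    using compact_attains_sup[OF assms(1) False] by auto
  have bd: "\<exists>K. \<forall>\<theta>\<in>\<Theta>. \<bar>\<Lambda> \<theta> y\<bar> \<le> K" if "y \<in> S" for y
    using compact_imp_bounded[OF compact_continuous_image[OF cont[OF that] assms(2)]]
    by (auto simp: bounded_iff)
  obtain Ka Kb where K: "\<And>\<theta>. \<theta> \<in> \<Theta> \<Longrightarrow> \<bar>\<Lambda> \<theta> a\<bar> \<le> Ka" "\<And>\<theta>. \<theta> \<in> \<Theta> \<Longrightarrow> \<bar>\<Lambda> \<theta> b\<bar> \<le> Kb"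
    using bd[OF a(1)] bd[OF b(1)] by auto
  \<comment> \<open>Absolute values make the bound nonnegative also for empty \<Theta>, where
    \<open>Ka\<close> and \<open>Kb\<close> are unconstrained.\<close>
  show ?thesis
  proof (rule that[of "\<bar>Ka\<bar> + \<bar>Kb\<bar>"])
    fix \<theta> y assume "\<theta> \<in> \<Theta>" "y \<in> S"
    then have "\<Lambda> \<theta> a \<le> \<Lambda> \<theta> y" "\<Lambda> \<theta> y \<le> \<Lambda> \<theta> b"
      using a b mono by (auto dest: monoD)
    with K[OF \<open>\<theta> \<in> \<Theta>\<close>] show "\<bar>\<Lambda> \<theta> y\<bar> \<le> \<bar>Ka\<bar> + \<bar>Kb\<bar>"
      by linarith
  qed simp
qed

lemma weighted_square_perturbation:
  fixes u :: real
  assumes "0 \<le> u" "u \<le> W" "\<bar>v * c + d\<bar> \<le> L" "0 \<le> c" "c \<le> C" "\<bar>k - v\<bar> \<le> \<eta>"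
  shows "u * (v * c + d)\<^sup>2 - 2 * W * L * C * \<eta> \<le> u * (k * c + d)\<^sup>2"
proof -
  define a where "a = v * c + d"
  define r where "r = (k - v) * c"
  have "\<bar>r\<bar> \<le> \<eta> * C"
    unfolding r_def abs_mult using assms by (intro mult_mono) auto
  then have "\<bar>a\<bar> * \<bar>r\<bar> \<le> L * (\<eta> * C)"
    using assms by (intro mult_mono) (auto simp: a_def)
  then have ar: "\<bar>a * r\<bar> \<le> L * (\<eta> * C)"
    by (simp add: abs_mult)
  \<comment> \<open>Replacing \<open>u\<close> by \<open>W\<close> needs
    \<open>L * (\<eta> * C)\<close> nonnegative, which follows from \<open>ar\<close>.\<close>
  have "u * (L * (\<eta> * C)) \<le> W * (L * (\<eta> * C))"
    using assms ar by (intro mult_right_mono) auto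
  moreover have "u * (- (L * (\<eta> * C))) \<le> u * (a * r)"
    using ar assms(1) by (intro mult_left_mono) auto
  moreover have "0 \<le> u * r\<^sup>2"
    using assms(1) by simp
  moreover have "u * (k * c + d)\<^sup>2 = u * a\<^sup>2 + 2 * (u * (a * r)) + u * r\<^sup>2"
    by (simp add: a_def r_def power2_eq_square algebra_simps)
  ultimately show ?thesis
    by (simp add: a_def algebra_simps)
qed

text \<open>Smoothness in \<theta> is known only for \<open>y\<close> in the support of
  \<open>w\<close>; at all other \<open>y\<close> the weight makes the function identically
  0.\<close>

lemma continuous_on_weighted_residual:
  assumes "C2_in_parameter \<Lambda> (func_support w) \<Theta>"
  shows "continuous_on (C1 \<times> C2 \<times> \<Theta>)
    (\<lambda>\<gamma>. w y * (v * fst \<gamma> + fst (snd \<gamma>) - \<Lambda> (snd (snd \<gamma>)) y)\<^sup>2)"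
proof (cases "w y = 0")
  case False
  then have "y \<in> func_support w"
    using closure_subset[of "{y. w y \<noteq> 0}"] by (auto simp: func_support_def)
  then have "continuous_on \<Theta> (\<lambda>\<theta>. \<Lambda> \<theta> y)"
    by (rule continuous_on_C2_in_parameter[OF assms])
  then have "continuous_on (C1 \<times> C2 \<times> \<Theta>) (\<lambda>\<gamma>. \<Lambda> (snd (snd \<gamma>)) y)"
    by (rule continuous_on_compose2) (auto intro!: continuous_intros)
  then show ?thesis
    by (intro continuous_intros)
qed auto

text \<open>The distance is an infimum over all positive \<open>c1\<close> and real
  \<open>c2\<close>, bounded below by nonnegativity of the integrals. This turns the alternative
  into positivity of the criterion.\<close>

lemma transformation_dist_le_criterion:
  assumes "c1 > 0" "\<And>y. w y \<ge> 0"
  shows "transformation_dist M w Y (\<Lambda> \<theta>) h \<le> criterion M w Y h \<Lambda> (c1, c2, \<theta>)"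
proof -
  have "bdd_below ((\<lambda>(c1, c2). \<integral>\<omega>. w (Y \<omega>) * (h (Y \<omega>) * c1 + c2 - \<Lambda> \<theta> (Y \<omega>))\<^sup>2 \<partial>M)
      ` ({0<..} \<times> UNIV))"
    using assms(2) by (intro bdd_belowI[of _ 0]) (auto intro!: integral_nonneg)
  then show ?thesis
    unfolding transformation_dist_def criterion_def
    using assms(1) by (intro cINF_lower2[where x = "(c1, c2)"]) auto
qed


theorem theorem3p3:
  fixes M :: "'a measure"
    and X :: "'a \<Rightarrow> real ^ 'x" and Y :: "'a \<Rightarrow> real" and eps :: "'a \<Rightarrow> real"
    and Xs :: "nat \<Rightarrow> 'a \<Rightarrow> real ^ 'x" and Ys :: "nat \<Rightarrow> 'a \<Rightarrow> real"
    and h :: "real \<Rightarrow> real" and g :: "real ^ 'x \<Rightarrow> real" and w :: "real \<Rightarrow> real"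
    and C1 C2 :: "real set" and \<Theta> :: "(real ^ 't) set"
    and \<Lambda> :: "real ^ 't \<Rightarrow> real \<Rightarrow> real"
    and hhat :: "nat \<Rightarrow> (nat \<Rightarrow> (real ^ 'x) \<times> real) \<Rightarrow> real \<Rightarrow> real"
    and \<gamma>0 :: "real \<times> real \<times> (real ^ 't)"
  defines "\<Upsilon> \<equiv> C1 \<times> C2 \<times> \<Theta>"
    and "h_est \<equiv> \<lambda>n \<omega>. hhat n (\<lambda>i\<in>{1..n}. (Xs i \<omega>, Ys i \<omega>))"
  defines "T \<equiv> \<lambda>n \<omega>. test_statistic w \<Lambda> \<Upsilon> n (h_est n \<omega>) (\<lambda>j. Ys j \<omega>)"
  assumes "prob_space M"
    and "X \<in> borel_measurable M" and "Y \<in> borel_measurable M"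
    and "iid_copies M (\<lambda>i \<omega>. (Xs i \<omega>, Ys i \<omega>)) {1..} (\<lambda>\<omega>. (X \<omega>, Y \<omega>))"
    and "normalized_transformation h"
    and "transformation_model M X Y h g eps"
    and "\<And>\<theta>. \<theta> \<in> \<Theta> \<Longrightarrow> strict_mono (\<Lambda> \<theta>)"
    and "\<And>n j. j \<in> {1..n} \<Longrightarrow> (\<lambda>\<omega>. h_est n \<omega> (Ys j \<omega>)) \<in> borel_measurable M"
    and A1: "compact C1" "C1 \<subseteq> {0<..}" "compact C2" "compact \<Theta>"
    and A2: "\<And>y. w y \<ge> 0" "continuous_on UNIV w" "compact (func_support w)"
      "func_support w \<subseteq> law_support M Y"
    and A3: "C2_in_parameter \<Lambda> (func_support w) \<Theta>"
    and A4: "continuous_on UNIV h"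
      "\<exists>!h'. normalized_transformation h' \<and> continuous_on UNIV h' \<and>
             (\<exists>g' eps'. transformation_model M X Y h' g' eps')"
    and A5: "is_arg_min (criterion M w Y h \<Lambda>) (\<lambda>\<gamma>. \<gamma> \<in> \<Upsilon>) \<gamma>0"
      "\<And>\<gamma>. is_arg_min (criterion M w Y h \<Lambda>) (\<lambda>\<gamma>. \<gamma> \<in> \<Upsilon>) \<gamma> \<Longrightarrow> \<gamma> = \<gamma>0"
      "\<gamma>0 \<in> interior \<Upsilon>"
      "\<And>\<theta> \<theta>'. \<theta> \<in> \<Theta> \<Longrightarrow> \<theta>' \<in> \<Theta> \<Longrightarrow> \<theta> \<noteq> \<theta>' \<Longrightarrow>
         (SUP y\<in>func_support w.
            ennreal \<bar>(\<Lambda> \<theta> y - \<Lambda> \<theta> 0) / (\<Lambda> \<theta> 1 - \<Lambda> \<theta> 0)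
                     - (\<Lambda> \<theta>' y - \<Lambda> \<theta>' 0) / (\<Lambda> \<theta>' 1 - \<Lambda> \<theta>' 0)\<bar>) > 0"
    and A6: "\<And>K. compact K \<Longrightarrow>
               oP_one M (\<lambda>n \<omega>. SUP y\<in>K. ennreal \<bar>h_est n \<omega> y - h y\<bar>)"
    and H1: "\<And>\<theta>. \<theta> \<in> \<Theta> \<Longrightarrow> transformation_dist M w Y (\<Lambda> \<theta>) h > 0"
  shows "\<forall>q::real. (\<lambda>n. measure M {\<omega> \<in> space M. T n \<omega> > q}) \<longlonglongrightarrow> 1"
proof
  fix q :: real
  interpret prob_space M by fact
  define S where "S = func_support w"
  \<comment> \<open>Projections make \<open>\<gamma>\<close> a single point of a metric space, the
    form in which the lemmas on infima and the uniform law take their parameter.\<close>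
  define f where "f = (\<lambda>\<gamma> y. w y * (h y * fst \<gamma> + fst (snd \<gamma>) - \<Lambda> (snd (snd \<gamma>)) y)\<^sup>2)"
  have w_out: "w y = 0" if "y \<notin> S" for y
    using that closure_subset[of "{y. w y \<noteq> 0}"] by (auto simp: S_def func_support_def)
  have w_meas[measurable]: "w \<in> borel_measurable borel"
    using A2(2) by (rule borel_measurable_continuous_onI)
  have h_meas[measurable]: "h \<in> borel_measurable borel"
    using A4(1) by (rule borel_measurable_continuous_onI)
  have Lam_mono: "mono (\<Lambda> \<theta>)" if "\<theta> \<in> \<Theta>" for \<theta>
    using assms(10)[OF that] by (rule strict_mono_mono)
  \<comment> \<open>Measurability in \<open>y\<close> comes from monotonicity, because
    \<open>A3\<close> gives joint continuity only of the derivatives in \<theta>.\<close>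
  have Lam_meas: "\<Lambda> \<theta> \<in> borel_measurable borel" if "\<theta> \<in> \<Theta>" for \<theta>
    using Lam_mono[OF that] by (rule borel_measurable_mono)
  have Ups: "compact \<Upsilon>" "\<gamma>0 \<in> \<Upsilon>"
    using A1 A5(3) interior_subset by (auto simp: \<Upsilon>_def intro!: compact_Times)

  \<comment> \<open>Uniform bounds on the weight and the residuals\<close>
  obtain W where W: "W > 0" "\<And>y. w y \<le> W"
  proof -
    have "bounded (w ` S)"
      using A2(2,3) by (intro compact_imp_bounded compact_continuous_image)
        (auto simp: S_def intro: continuous_on_subset)
    then obtain W where W: "W > 0" "\<forall>x\<in>w ` S. norm x \<le> W"
      by (auto simp: bounded_pos)
    have "w y \<le> W" for y
      using W w_out[of y] by (cases "y \<in> S") (auto simp: abs_le_iff)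
    with W(1) show ?thesis by (rule that)
  qed
  obtain H where H: "H > 0" "\<And>y. y \<in> S \<Longrightarrow> \<bar>h y\<bar> \<le> H"
  proof -
    have "bounded (h ` S)"
      using A4(1) A2(3) by (intro compact_imp_bounded compact_continuous_image)
        (auto simp: S_def intro: continuous_on_subset)
    then show ?thesis
      using that by (auto simp: bounded_pos)
  qed
  obtain K1 where K1: "K1 > 0" "\<And>c. c \<in> C1 \<Longrightarrow> \<bar>c\<bar> \<le> K1"
    using compact_imp_bounded[OF A1(1)] by (auto simp: bounded_pos)
  obtain K2 where K2: "K2 > 0" "\<And>c. c \<in> C2 \<Longrightarrow> \<bar>c\<bar> \<le> K2"
    using compact_imp_bounded[OF A1(3)] by (auto simp: bounded_pos)
  obtain B where B: "B \<ge> 0" "\<And>\<theta> y. \<theta> \<in> \<Theta> \<Longrightarrow> y \<in> S \<Longrightarrow> \<bar>\<Lambda> \<theta> y\<bar> \<le> B"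
    using bounded_monotone_family[OF A2(3) A1(4) Lam_mono continuous_on_C2_in_parameter[OF A3]]
    unfolding S_def by metis
  \<comment> \<open>The triangle inequality bounds the residual with the true \<open>h\<close> by
    \<open>L\<close>. The bounds were taken strictly positive so that \<eta> can later be defined
    with \<open>L\<close> in the denominator.\<close>
  define L where "L = H * K1 + K2 + B"
  have L: "L > 0"
    using H K1 K2 B by (simp add: L_def add_pos_nonneg)
  have res: "\<bar>h y * c1 + c2 - \<Lambda> \<theta> y\<bar> \<le> L" if "y \<in> S" "c1 \<in> C1" "c2 \<in> C2" "\<theta> \<in> \<Theta>" for y c1 c2 \<theta>
  proof -
    have "\<bar>h y * c1\<bar> \<le> H * K1"
      unfolding abs_mult using H(1) H(2)[OF that(1)] K1(2)[OF that(2)] by (intro mult_mono) auto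
    then show ?thesis
      using K2(2)[OF that(3)] B(2)[OF that(4,1)] unfolding L_def by linarith
  qed

  \<comment> \<open>Regularity of the weighted squared residuals\<close>
  have f_cont: "continuous_on \<Upsilon> (\<lambda>\<gamma>. f \<gamma> y)" for y
    unfolding f_def \<Upsilon>_def by (rule continuous_on_weighted_residual[OF A3])
  have f_meas: "f \<gamma> \<in> borel_measurable borel" if "\<gamma> \<in> \<Upsilon>" for \<gamma>
  proof -
    have [measurable]: "\<Lambda> (snd (snd \<gamma>)) \<in> borel_measurable borel"
      using that by (intro Lam_meas) (auto simp: \<Upsilon>_def)
    show ?thesis unfolding f_def by measurable
  qed
  have f_bounds: "f \<gamma> y \<in> {0..W * L\<^sup>2}" if "\<gamma> \<in> \<Upsilon>" for \<gamma> y
  proof (cases "y \<in> S")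
    case True
    then have "(h y * fst \<gamma> + fst (snd \<gamma>) - \<Lambda> (snd (snd \<gamma>)) y)\<^sup>2 \<le> L\<^sup>2"
      using that by (intro power2_le_iff_abs_le[THEN iffD2] res less_imp_le[OF L]) (auto simp: \<Upsilon>_def)
    then have "f \<gamma> y \<le> W * L\<^sup>2"
      unfolding f_def using A2(1) W by (intro mult_mono) auto
    then show ?thesis
      using A2(1) by (auto simp: f_def)
  qed (use W w_out in \<open>auto simp: f_def\<close>)

  \<comment> \<open>Separation of the criterion from zero\<close>
  define m where "m = criterion M w Y h \<Lambda> \<gamma>0"
  have crit: "criterion M w Y h \<Lambda> \<gamma> = (\<integral>\<omega>. f \<gamma> (Y \<omega>) \<partial>M)" for \<gamma>
    by (simp add: criterion_def f_def case_prod_unfold)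
  obtain c1 c2 \<theta>0 where \<gamma>0: "\<gamma>0 = (c1, c2, \<theta>0)" "c1 \<in> C1" "\<theta>0 \<in> \<Theta>"
    using Ups(2) by (auto simp: \<Upsilon>_def)
  \<comment> \<open>\<open>H1\<close> is applied at the minimizer's parameter
    \<open>\<theta>0\<close>; minimality of \<open>\<gamma>0\<close> then makes \<open>m\<close> a
    positive lower bound on all of \<Upsilon>.\<close>
  have "0 < transformation_dist M w Y (\<Lambda> \<theta>0) h"
    using \<gamma>0 by (intro H1)
  also have "\<dots> \<le> m"
    unfolding m_def \<gamma>0(1) using \<gamma>0(2) A1(2) A2(1) by (intro transformation_dist_le_criterion) auto
  finally have m: "m > 0" .
  \<comment> \<open>The uniform law needs a strict gap below every mean, and \<open>m\<close> itself
    is attained at \<open>\<gamma>0\<close>. Half of \<open>m\<close> also leaves room for the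
    estimation error \<open>m / 4\<close>.\<close>
  have mean: "m / 2 < (\<integral>\<omega>. f \<gamma> (Y \<omega>) \<partial>M)" if "\<gamma> \<in> \<Upsilon>" for \<gamma>
  proof -
    have "m \<le> criterion M w Y h \<Lambda> \<gamma>"
      using A5(1) that by (cases \<gamma>) (simp add: is_arg_min_linorder m_def)
    then show ?thesis
      using m by (simp add: crit)
  qed

  \<comment> \<open>Exceptional events for sampling and for estimation\<close>
  have iid: "iid_copies M Ys {1..} Y"
    using iid_copies_compose[OF assms(4,7), where \<phi> = snd] assms(5,6)
    by (simp add: borel_measurable_Pair borel_measurable_continuous_onI continuous_on_snd)
  obtain A where A: "\<And>n. A n \<in> sets M" "(\<lambda>n. prob (A n)) \<longlonglongrightarrow> 0"
    "\<And>n \<omega> \<gamma>. \<omega> \<in> space M - A n \<Longrightarrow> \<gamma> \<in> \<Upsilon> \<Longrightarrow> real n * (m / 2) \<le> (\<Sum>j=1..n. f \<gamma> (Ys j \<omega>))"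
    by (rule uniform_law_lower_bound[OF assms(4) iid assms(6) Ups(1) f_meas f_cont f_bounds mean],
        assumption+, rule that)

  \<comment> \<open>Chosen so that the loss in \<open>weighted_square_perturbation\<close>, with
    \<open>C\<close> equal to \<open>K1\<close>, is exactly \<open>m / 4\<close>.\<close>
  define \<eta> where "\<eta> = m / (8 * W * L * K1)"
  have \<eta>: "\<eta> > 0" "2 * W * L * K1 * \<eta> = m / 4"
    using m W(1) L K1(1) by (auto simp: \<eta>_def)
  obtain D where D: "\<And>n. D n \<in> sets M" "(\<lambda>n. prob (D n)) \<longlonglongrightarrow> 0"
    "\<And>n \<omega>. \<omega> \<in> space M - D n \<Longrightarrow> (SUP y\<in>S. ennreal \<bar>h_est n \<omega> y - h y\<bar>) \<le> ennreal \<eta>"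
    by (rule oP_one_exceptional_set[OF A6[OF A2(3), folded S_def] assms(4) \<eta>(1)], rule that)
  have hD: "\<bar>h_est n \<omega> y - h y\<bar> \<le> \<eta>" if "\<omega> \<in> space M - D n" "y \<in> S" for n \<omega> y
  proof -
    have "ennreal \<bar>h_est n \<omega> y - h y\<bar> \<le> (SUP y\<in>S. ennreal \<bar>h_est n \<omega> y - h y\<bar>)"
      using that(2) by (rule SUP_upper)
    also note D(3)[OF that(1)]
    finally show ?thesis
      using \<eta>(1) by (simp add: ennreal_le_iff)
  qed

  \<comment> \<open>Measurability of the test statistic\<close>
  have T_eq: "T n \<omega> = (INF \<gamma>\<in>\<Upsilon>. \<Sum>j=1..n. w (Ys j \<omega>) *
      (h_est n \<omega> (Ys j \<omega>) * fst \<gamma> + fst (snd \<gamma>) - \<Lambda> (snd (snd \<gamma>)) (Ys j \<omega>))\<^sup>2)" for n \<omega>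
    by (simp add: T_def test_statistic_def case_prod_unfold)
  have Ys_meas: "Ys j \<in> borel_measurable M" if "j \<in> {1..n}" for j n
    using iid that by (auto simp: iid_copies_def indep_vars_def)
  \<comment> \<open>Without measurability the event that \<open>T n\<close> exceeds \<open>q\<close>
    could have \<open>measure\<close> 0 by default, and comparison with a subset would fail.\<close>
  have T_meas[measurable]: "T n \<in> borel_measurable M" for n
    unfolding T_eq
  proof (rule borel_measurable_INF_continuous)
    fix \<gamma> assume "\<gamma> \<in> \<Upsilon>"
    then have [measurable]: "\<Lambda> (snd (snd \<gamma>)) \<in> borel_measurable borel"
      by (intro Lam_meas) (auto simp: \<Upsilon>_def)
    show "(\<lambda>\<omega>. \<Sum>j=1..n. w (Ys j \<omega>) *
      (h_est n \<omega> (Ys j \<omega>) * fst \<gamma> + fst (snd \<gamma>) - \<Lambda> (snd (snd \<gamma>)) (Ys j \<omega>))\<^sup>2) \<in> borel_measurable M"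
    proof (rule borel_measurable_sum)
      fix j assume j: "j \<in> {1..n}"
      \<comment> \<open>Measurability of the estimated transformation is available at the
        observations 1 to \<open>n\<close>, which are exactly those in the sum.\<close>
      note [measurable] = assms(11)[OF j] Ys_meas[OF j]
      show "(\<lambda>\<omega>. w (Ys j \<omega>) * (h_est n \<omega> (Ys j \<omega>) * fst \<gamma> + fst (snd \<gamma>)
        - \<Lambda> (snd (snd \<gamma>)) (Ys j \<omega>))\<^sup>2) \<in> borel_measurable M"
        by measurable
    qed
  next
    fix \<omega>
    show "continuous_on \<Upsilon> (\<lambda>\<gamma>. \<Sum>j=1..n. w (Ys j \<omega>) *
      (h_est n \<omega> (Ys j \<omega>) * fst \<gamma> + fst (snd \<gamma>) - \<Lambda> (snd (snd \<gamma>)) (Ys j \<omega>))\<^sup>2)"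
      unfolding \<Upsilon>_def by (intro continuous_on_sum continuous_on_weighted_residual A3)
    show "bdd_below ((\<lambda>\<gamma>. \<Sum>j=1..n. w (Ys j \<omega>) *
      (h_est n \<omega> (Ys j \<omega>) * fst \<gamma> + fst (snd \<gamma>) - \<Lambda> (snd (snd \<gamma>)) (Ys j \<omega>))\<^sup>2) ` \<Upsilon>)"
      using A2(1) by (intro bdd_belowI[of _ 0]) (auto intro!: sum_nonneg)
  qed (use Ups in auto)

  \<comment> \<open>Lower bound for the statistic off the exceptional events\<close>
  have T_lower: "real n * (m / 4) \<le> T n \<omega>" if \<omega>: "\<omega> \<in> space M - (A n \<union> D n)" for n \<omega>
    unfolding T_eq
  proof (rule cINF_greatest)
    fix \<gamma> assume \<gamma>: "\<gamma> \<in> \<Upsilon>"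
    \<comment> \<open>This holds for every real \<open>y\<close>, hence at all observations: on
      \<open>S\<close> the estimate is within \<eta> of \<open>h\<close>, and off \<open>S\<close>
      both weighted squares vanish.\<close>
    have "f \<gamma> y - m / 4 \<le> w y * (h_est n \<omega> y * fst \<gamma> + fst (snd \<gamma>) - \<Lambda> (snd (snd \<gamma>)) y)\<^sup>2" for y
    proof (cases "y \<in> S")
      case True
      have "w y * (h y * fst \<gamma> + (fst (snd \<gamma>) - \<Lambda> (snd (snd \<gamma>)) y))\<^sup>2 - 2 * W * L * K1 * \<eta>
        \<le> w y * (h_est n \<omega> y * fst \<gamma> + (fst (snd \<gamma>) - \<Lambda> (snd (snd \<gamma>)) y))\<^sup>2"
        using True \<gamma> \<omega> A1(2) A2(1) W(2) K1(2)[of "fst \<gamma>"] hD[of \<omega> n y]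
          res[of y "fst \<gamma>" "fst (snd \<gamma>)" "snd (snd \<gamma>)"]
        by (intro weighted_square_perturbation) (auto simp: \<Upsilon>_def add_diff_eq)
      then show ?thesis
        by (simp add: f_def \<eta>(2) add_diff_eq)
    qed (use w_out m in \<open>auto simp: f_def\<close>)
    then have "(\<Sum>j=1..n. f \<gamma> (Ys j \<omega>) - m / 4) \<le> (\<Sum>j=1..n. w (Ys j \<omega>) *
      (h_est n \<omega> (Ys j \<omega>) * fst \<gamma> + fst (snd \<gamma>) - \<Lambda> (snd (snd \<gamma>)) (Ys j \<omega>))\<^sup>2)"
      by (intro sum_mono)
    moreover have "real n * (m / 2) \<le> (\<Sum>j=1..n. f \<gamma> (Ys j \<omega>))"
      using \<omega> \<gamma> by (intro A) auto
    ultimately show "real n * (m / 4) \<le> (\<Sum>j=1..n. w (Ys j \<omega>) *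
      (h_est n \<omega> (Ys j \<omega>) * fst \<gamma> + fst (snd \<gamma>) - \<Lambda> (snd (snd \<gamma>)) (Ys j \<omega>))\<^sup>2)"
      by (simp add: sum_subtractf)
  qed (use Ups in auto)

  \<comment> \<open>Passage to the limit\<close>
  have "filterlim (\<lambda>n. m / 4 * real n) at_top sequentially"
    using m by (intro filterlim_tendsto_pos_mult_at_top[OF tendsto_const] filterlim_real_sequentially) auto
  then have "eventually (\<lambda>n. q < real n * (m / 4)) sequentially"
    by (auto simp: filterlim_at_top_dense mult.commute)
  then have "eventually (\<lambda>n. 1 - (prob (A n) + prob (D n)) \<le> prob {\<omega> \<in> space M. T n \<omega> > q}) sequentially"
  proof eventually_elim
    case (elim n)
    have "1 - (prob (A n) + prob (D n)) \<le> 1 - prob (A n \<union> D n)"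
      using measure_Un_le[OF A(1) D(1), of n n] by simp
    also have "\<dots> = prob (space M - (A n \<union> D n))"
      using A(1) D(1) by (intro prob_compl[symmetric]) auto
    also have "\<dots> \<le> prob {\<omega> \<in> space M. T n \<omega> > q}"
      using elim T_lower by (intro finite_measure_mono) fastforce+
    finally show ?case .
  qed
  moreover have "eventually (\<lambda>n. prob {\<omega> \<in> space M. T n \<omega> > q} \<le> 1) sequentially"
    by (intro always_eventually allI prob_le_1)
  moreover have "(\<lambda>n. 1 - (prob (A n) + prob (D n))) \<longlonglongrightarrow> 1"
    by (rule tendsto_eq_intros A D | simp)+
  ultimately show "(\<lambda>n. prob {\<omega> \<in> space M. T n \<omega> > q}) \<longlonglongrightarrow> 1"
    by (rule tendsto_sandwich[OF _ _ _ tendsto_const])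
qed

end
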